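(* Assume (A0), (A1) and (A2), and let $(v^k)$, $(\varphi^k)$ with $\varphi^k=(\psi^k,\delta^k)$ be the sequences generated by the iterative algorithm. Then for all $k\ge0$ $$\mathbb A(\varphi^k,\varphi^{k+1})\,v^{k+1}=\mathbb B(\varphi^k)\,v^k+\mathbb C(\varphi^k,\varphi^{k+1}),$$ where: (i) $\psi^k=\mathbf 1_{\{Lv^k+f\le Mv^k-v^k\}\cap G_{<0}}$ and $\delta^k\in\operatorname{argmax}_{\delta\in Z}\{B(\delta)v^k-c(\delta)\}$; (ii) for $\varphi=(\psi,\delta),\overline\varphi=(\overline\psi,\overline\delta)\in\Phi$, $\mathbb A(\varphi,\overline\varphi)=\operatorname{Id}-(\operatorname{Id}-\overline\Psi-S\Psi S)(\operatorname{Id}+L)-\overline\Psi B(\overline\delta)$ is a WCDD $L_0$-matrix, and thus a nonsingular M-matrix; (iii) $\mathbb B(\varphi)=S\Psi B(\delta)S=\operatorname{diag}(S\psi)\,SB(\delta)S$ is substochastic; (iv) $\mathbb C(\varphi,\overline\varphi)=(\operatorname{Id}-\overline\Psi-S\Psi S)f-\overline\Psi c(\overline\delta)+S\Psi S\,g(S\delta)$.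
   Context: Grid and operators. $G$ is a symmetric grid $x_{-N}=-x_N<\dots<x_{-1}=-x_1<x_0=0<x_1<\dots<x_N$ of real numbers; $\mathbb R^G$ is the set of functions $G\to\mathbb R$ (vectors), linear operators on $\mathbb R^G$ are identified with matrices in $\mathbb R^{G\times G}$, and orders, max, argmax are pointwise (elementwise). $S$ is the symmetry operator $Sv(x)=v(-x)$. $G_{<0}$ is the set of negative grid points; complements are taken in $G$. $f\in\mathbb R^G$ and $L:\mathbb R^G\to\mathbb R^G$ is linear. For each $x\in G$, $Z(x)\subseteq\mathbb R$ is a finite nonempty set, with $Z(x)=\{0\}$ if $x\ge0$; $Z=\prod_{x\in G}Z(x)$. For each $\delta\in Z$ there are given a linear $B(\delta):\mathbb R^G\to\mathbb R^G$, $c(\delta)\in(0,+\infty)^G$ and a vector $g(S\delta)\in\mathbb R^G$; these are row-decoupled: row $x$ of $B(\delta)$ and $c(\delta)$ depends only on $\delta(x)$, and entry $x$ of $g(S\delta)$ depends only on $(S\delta)(x)=\delta(-x)$. Define $Mv=\max_{\delta\in Z}\{B(\delta)v-c(\delta)\}$, $\delta^*(v)=\max(\operatorname{argmax}_{\delta\in Z}\{B(\delta)v-c(\delta)\})$ (pointwise largest maximizer) and $H(\delta)v=SB(\delta)Sv+g(S\delta)$. Strategies. $\Phi=\{\varphi=(I,\delta): I\subseteq G_{<0},\ \delta\in Z\}$. Each $I\subseteq G_{<0}$ is identified with its indicator $\psi=\mathbf 1_I\in\{0,1\}^G$, and $\psi$ with the diagonal matrix $\Psi=\operatorname{diag}(\psi)$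 (likewise $\overline I,\overline\psi,\overline\Psi$). Algorithm (run indefinitely, with the single-player problems solved exactly). Choose $v^0\in\mathbb R^G$, set $I^0=\{Lv^0+f\le Mv^0-v^0\}\cap G_{<0}$ and $\delta^0=\delta^*(v^0)$. For $k=0,1,\dots$: let $v^{k+1/2}=H(\delta^k)v^k$ on $-I^k$ and $v^{k+1/2}=v^k$ on $(-I^k)^c$; with $D=(-I^k)^c$, let $v^{k+1}\in\mathbb R^G$ be the (unique) solution of $\max\{Lv+f,Mv-v\}=0$ on $D$ subject to $v=v^{k+1/2}$ on $D^c$; set $I^{k+1}=\{x\in D: (Lv^{k+1}+f)(x)\le\lambda(Mv^{k+1}-v^{k+1})(x)\}$ (intervention regions being understood as subsets of $G_{<0}$), where $\lambda>0$ is a fixed scaling factor, and $\delta^{k+1}=\delta^*(v^{k+1})$. $\psi^k=\mathbf 1_{I^k}$. Matrix notions. For a real square matrix $A$: row $i$ is WDD (resp. SDD) if $|A_{ii}|\ge\sum_{j\ne i}|A_{ij}|$ (resp. $>$); $A$ is WDD (SDD) if all rows are; $A$ is an $L_0$-matrix if its off-diagonal entries are $\le0$ and its diagonal entries are $\ge0$; $A$ is an M-matrix if $A=s\operatorname{Id}-B$ with $B\ge0$ and $s\ge\rho(B)$ (spectral radius); $A$ is substochastic if $A\ge0$ with row sums at most one. graph$A$ is the directed graph on the row indices with an edge $(i,j)$ iff $A_{ij}\neq0$; a walk is a nonempty finite sequence of consecutive edges. $A$ is WCDD if it is WDD and from each WDD row there is a walk in graph$A$ to an SDD row. Assumptions.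 (A0) For each $\varphi=(I,\delta)\in\Phi$ and $x\in I$ there is a walk in graph$B(\delta)$ from row $x$ to some row $y\in I^c$. (A1) $-L$ is an SDD $L_0$-matrix and, for each $\delta\in Z$, $\operatorname{Id}-B(\delta)$ is a WDD $L_0$-matrix. (A2) $B(\delta)$ has nonnegative diagonal elements for all $\delta\in Z$.
   Formalization: The sets I^{k+1} computed on D are assumed to lie in G_{<0}; if they were only intersected with G_{<0}, the equation could fail at x≥0 (L=-Id, f=-10, c=1, zero rows of B at x≥0). This is automatic when rows x≥0 of B(δ) are those of Id. *)

theory Defs
  imports "HOL-Analysis.Analysis"
begin

section \<open>Matrices\<close>

definition wdd_row :: "real^'n^'n \<Rightarrow> 'n::finite \<Rightarrow> bool" where
  "wdd_row A i \<longleftrightarrow> \<bar>A $ i $ i\<bar> \<ge> (\<Sum>j\<in>UNIV - {i}. \<bar>A $ i $ j\<bar>)"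

definition sdd_row :: "real^'n^'n \<Rightarrow> 'n::finite \<Rightarrow> bool" where
  "sdd_row A i \<longleftrightarrow> \<bar>A $ i $ i\<bar> > (\<Sum>j\<in>UNIV - {i}. \<bar>A $ i $ j\<bar>)"

definition wdd :: "real^'n^'n::finite \<Rightarrow> bool" where
  "wdd A \<longleftrightarrow> (\<forall>i. wdd_row A i)"

definition sdd :: "real^'n^'n::finite \<Rightarrow> bool" where
  "sdd A \<longleftrightarrow> (\<forall>i. sdd_row A i)"

definition L0_matrix :: "real^'n^'n::finite \<Rightarrow> bool" where
  "L0_matrix A \<longleftrightarrow> (\<forall>i j. i \<noteq> j \<longrightarrow> A $ i $ j \<le> 0) \<and> (\<forall>i. A $ i $ i \<ge> 0)"

text \<open>Walks are nonempty, so the rows reachable by a walk are those reachable in the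
  transitive (not reflexive) closure.\<close>

definition mat_graph :: "real^'n^'n::finite \<Rightarrow> ('n \<times> 'n) set" where
  "mat_graph A = {(i, j). A $ i $ j \<noteq> 0}"

definition wcdd :: "real^'n^'n::finite \<Rightarrow> bool" where
  "wcdd A \<longleftrightarrow> wdd A \<and> (\<forall>i. wdd_row A i \<longrightarrow> (\<exists>j. sdd_row A j \<and> (i, j) \<in> (mat_graph A)\<^sup>+))"

definition spec_rad :: "real^'n^'n::finite \<Rightarrow> real" where
  "spec_rad A = Max {cmod \<mu> | \<mu>. \<exists>u::complex^'n. u \<noteq> 0 \<and> map_matrix complex_of_real A *v u = \<mu> *s u}"

definition M_matrix :: "real^'n^'n::finite \<Rightarrow> bool" where
  "M_matrix A \<longleftrightarrow> (\<exists>s P. A = s *\<^sub>R mat 1 - P \<and> 0 \<le> P \<and> s \<ge> spec_rad P)"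

definition substochastic :: "real^'n^'n::finite \<Rightarrow> bool" where
  "substochastic A \<longleftrightarrow> 0 \<le> A \<and> (\<forall>i. (\<Sum>j\<in>UNIV. A $ i $ j) \<le> 1)"

definition diag_mat :: "real^'n \<Rightarrow> real^'n^'n::finite" where
  "diag_mat d = (\<chi> i j. if i = j then d $ i else 0)"

definition ind_vec :: "'n set \<Rightarrow> real^'n::finite" where
  "ind_vec I = (\<chi> i. indicator I i)"


section \<open>The grid\<close>

text \<open>The elements of the finite index type \<open>'g\<close> name the grid points, and \<open>pt\<close> gives their
  position on the real line: \<open>G = range pt\<close>.  A finite symmetric set of reals containing \<open>0\<close>
  is the same thing as a grid \<open>x\<^bsub>-N\<^esub> = -x\<^bsub>N\<^esub> < ... < x\<^bsub>0\<^esub> = 0 < ... < x\<^bsub>N\<^esub>\<close>.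
  Subsets of \<open>G\<close> are sets of indices.\<close>

definition symmetric_grid :: "('g::finite \<Rightarrow> real) \<Rightarrow> bool" where
  "symmetric_grid pt \<longleftrightarrow> inj pt \<and> 0 \<in> range pt \<and> uminus ` range pt = range pt"

text \<open>\<open>refl_pt pt x\<close> is the grid point at position \<open>- pt x\<close>; the reflected set \<open>{-x | x \<in> I}\<close> is
  \<open>refl_pt pt ` I\<close>, whereas \<open>- I\<close> always is the complement of \<open>I\<close> in \<open>G\<close>.\<close>

definition refl_pt :: "('g::finite \<Rightarrow> real) \<Rightarrow> 'g \<Rightarrow> 'g" where
  "refl_pt pt x = inv pt (- pt x)"

definition sym_op :: "('g::finite \<Rightarrow> real) \<Rightarrow> real^'g^'g" where
  "sym_op pt = matrix (\<lambda>v. \<chi> x. v $ refl_pt pt x)"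

definition G_neg :: "('g::finite \<Rightarrow> real) \<Rightarrow> 'g set" where
  "G_neg pt = {x. pt x < 0}"


section \<open>Impulses and strategies\<close>

definition impulses :: "('g::finite \<Rightarrow> real set) \<Rightarrow> (real^'g) set" where
  "impulses Z = {\<delta>. \<forall>x. \<delta> $ x \<in> Z x}"

definition strategies :: "('g::finite \<Rightarrow> real) \<Rightarrow> ('g \<Rightarrow> real set) \<Rightarrow> ('g set \<times> (real^'g)) set" where
  "strategies pt Z = {(I, \<delta>). I \<subseteq> G_neg pt \<and> \<delta> \<in> impulses Z}"

text \<open>\<open>B\<close> and \<open>c\<close> are indexed by \<open>\<delta> \<in> impulses Z\<close>, but \<open>g\<close> by the reflected impulse \<open>S\<delta>\<close>.\<close>

definition row_decoupled ::
  "('g::finite \<Rightarrow> real) \<Rightarrow> ('g \<Rightarrow> real set) \<Rightarrow> (real^'g \<Rightarrow> real^'g^'g) \<Rightarrow> (real^'g \<Rightarrow> real^'g)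
    \<Rightarrow> (real^'g \<Rightarrow> real^'g) \<Rightarrow> bool" where
  "row_decoupled pt Z B c g \<longleftrightarrow>
    (\<forall>\<delta>\<in>impulses Z. \<forall>\<delta>'\<in>impulses Z. \<forall>x.
      (\<delta> $ x = \<delta>' $ x \<longrightarrow> row x (B \<delta>) = row x (B \<delta>') \<and> c \<delta> $ x = c \<delta>' $ x) \<and>
      ((sym_op pt *v \<delta>) $ x = (sym_op pt *v \<delta>') $ x \<longrightarrow>
        g (sym_op pt *v \<delta>) $ x = g (sym_op pt *v \<delta>') $ x))"

definition M_op ::
  "('g::finite \<Rightarrow> real set) \<Rightarrow> (real^'g \<Rightarrow> real^'g^'g) \<Rightarrow> (real^'g \<Rightarrow> real^'g) \<Rightarrow> real^'g \<Rightarrow> real^'g" where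
  "M_op Z B c v = (\<chi> x. Max ((\<lambda>\<delta>. (B \<delta> *v v - c \<delta>) $ x) ` impulses Z))"

text \<open>Here \<open>\<le>\<close> is the pointwise order.\<close>

definition argmax_set ::
  "('g::finite \<Rightarrow> real set) \<Rightarrow> (real^'g \<Rightarrow> real^'g^'g) \<Rightarrow> (real^'g \<Rightarrow> real^'g) \<Rightarrow> real^'g \<Rightarrow> (real^'g) set" where
  "argmax_set Z B c v =
    {\<delta> \<in> impulses Z. \<forall>\<delta>'\<in>impulses Z. B \<delta>' *v v - c \<delta>' \<le> B \<delta> *v v - c \<delta>}"

definition delta_star ::
  "('g::finite \<Rightarrow> real set) \<Rightarrow> (real^'g \<Rightarrow> real^'g^'g) \<Rightarrow> (real^'g \<Rightarrow> real^'g) \<Rightarrow> real^'g \<Rightarrow> real^'g" where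
  "delta_star Z B c v = (\<chi> x. Max ((\<lambda>\<delta>. \<delta> $ x) ` argmax_set Z B c v))"

definition H_op ::
  "('g::finite \<Rightarrow> real) \<Rightarrow> (real^'g \<Rightarrow> real^'g^'g) \<Rightarrow> (real^'g \<Rightarrow> real^'g) \<Rightarrow> real^'g \<Rightarrow> real^'g \<Rightarrow> real^'g" where
  "H_op pt B g \<delta> v = (sym_op pt ** B \<delta> ** sym_op pt) *v v + g (sym_op pt *v \<delta>)"


section \<open>The algorithm\<close>

definition half_step ::
  "('g::finite \<Rightarrow> real) \<Rightarrow> (real^'g \<Rightarrow> real^'g^'g) \<Rightarrow> (real^'g \<Rightarrow> real^'g)
    \<Rightarrow> 'g set \<times> (real^'g) \<Rightarrow> real^'g \<Rightarrow> real^'g" where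
  "half_step pt B g \<phi> v =
    (\<chi> x. if x \<in> refl_pt pt ` fst \<phi> then H_op pt B g (snd \<phi>) v $ x else v $ x)"

definition solves_on ::
  "real^'g^'g \<Rightarrow> real^'g \<Rightarrow> ('g::finite \<Rightarrow> real set) \<Rightarrow> (real^'g \<Rightarrow> real^'g^'g) \<Rightarrow> (real^'g \<Rightarrow> real^'g)
    \<Rightarrow> 'g set \<Rightarrow> real^'g \<Rightarrow> real^'g \<Rightarrow> bool" where
  "solves_on L f Z B c D w v \<longleftrightarrow>
    (\<forall>x\<in>D. max ((L *v v + f) $ x) ((M_op Z B c v - v) $ x) = 0) \<and> (\<forall>x\<in>- D. v $ x = w $ x)"

text \<open>The regions computed in the loop are by construction sets of points of \<open>D\<close>; that they are
  intervention regions, i.e. subsets of \<open>G\<^bsub><0\<^esub>\<close>, is part of the notion of a run.  This is automatic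
  when the only impulse \<open>0\<close> available at \<open>x \<ge> 0\<close> acts trivially (row \<open>x\<close> of \<open>B \<delta>\<close> is that of
  the identity), since then \<open>(Mv - v)(x) = - c(x) < 0\<close> and hence \<open>(Lv + f)(x) = 0\<close> on \<open>D\<close>.\<close>

definition algorithm_run ::
  "('g::finite \<Rightarrow> real) \<Rightarrow> real^'g^'g \<Rightarrow> real^'g \<Rightarrow> ('g \<Rightarrow> real set) \<Rightarrow> (real^'g \<Rightarrow> real^'g^'g)
    \<Rightarrow> (real^'g \<Rightarrow> real^'g) \<Rightarrow> (real^'g \<Rightarrow> real^'g) \<Rightarrow> real
    \<Rightarrow> (nat \<Rightarrow> real^'g) \<Rightarrow> (nat \<Rightarrow> 'g set \<times> (real^'g)) \<Rightarrow> bool" where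
  "algorithm_run pt L f Z B c g lam v \<phi> \<longleftrightarrow>
    \<phi> 0 = ({x. (L *v v 0 + f) $ x \<le> (M_op Z B c (v 0) - v 0) $ x} \<inter> G_neg pt, delta_star Z B c (v 0)) \<and>
    (\<forall>k. let D = - (refl_pt pt ` fst (\<phi> k)) in
      solves_on L f Z B c D (half_step pt B g (\<phi> k) (v k)) (v (Suc k)) \<and>
      fst (\<phi> (Suc k)) =
        {x \<in> D. (L *v v (Suc k) + f) $ x \<le> lam * (M_op Z B c (v (Suc k)) - v (Suc k)) $ x} \<and>
      fst (\<phi> (Suc k)) \<subseteq> G_neg pt \<and>
      snd (\<phi> (Suc k)) = delta_star Z B c (v (Suc k)))"


section \<open>The fixed-point matrices\<close>

definition Psi :: "'g set \<times> (real^'g) \<Rightarrow> real^'g^'g::finite" where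
  "Psi \<phi> = diag_mat (ind_vec (fst \<phi>))"

definition AA ::
  "('g::finite \<Rightarrow> real) \<Rightarrow> real^'g^'g \<Rightarrow> (real^'g \<Rightarrow> real^'g^'g)
    \<Rightarrow> 'g set \<times> (real^'g) \<Rightarrow> 'g set \<times> (real^'g) \<Rightarrow> real^'g^'g" where
  "AA pt L B \<phi> \<phi>' = mat 1 - (mat 1 - Psi \<phi>' - sym_op pt ** Psi \<phi> ** sym_op pt) ** (mat 1 + L)
    - Psi \<phi>' ** B (snd \<phi>')"

definition BB ::
  "('g::finite \<Rightarrow> real) \<Rightarrow> (real^'g \<Rightarrow> real^'g^'g) \<Rightarrow> 'g set \<times> (real^'g) \<Rightarrow> real^'g^'g" where
  "BB pt B \<phi> = sym_op pt ** Psi \<phi> ** B (snd \<phi>) ** sym_op pt"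

definition CC ::
  "('g::finite \<Rightarrow> real) \<Rightarrow> real^'g \<Rightarrow> (real^'g \<Rightarrow> real^'g) \<Rightarrow> (real^'g \<Rightarrow> real^'g)
    \<Rightarrow> 'g set \<times> (real^'g) \<Rightarrow> 'g set \<times> (real^'g) \<Rightarrow> real^'g" where
  "CC pt f c g \<phi> \<phi>' = (mat 1 - Psi \<phi>' - sym_op pt ** Psi \<phi> ** sym_op pt) *v f
    - Psi \<phi>' *v c (snd \<phi>')
    + (sym_op pt ** Psi \<phi> ** sym_op pt) *v g (sym_op pt *v snd \<phi>)"

end

theory Submission
  imports Defs "HOL-Computational_Algebra.Fundamental_Theorem_Algebra"
begin

text \<open>
  Everything is decided row by row. The intervention region of the new strategy \<open>\<phi>'\<close> consists
  of negative points and the reflected region of the old strategy \<open>\<phi>\<close> of positive points, so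
  the two are disjoint, and every row of \<open>AA \<phi> \<phi>'\<close> is a row of exactly one of three matrices:
  \<open>Id - B(\<delta>')\<close> where the player intervenes, \<open>Id\<close> where the opponent does, and \<open>- L\<close>
  elsewhere (\<open>AA_row\<close>).

  \<^emph>\<open>The iteration.\<close> At a point outside the opponent's region the new iterate satisfies
  \<open>max {Lv + f, Mv - v} = 0\<close>. Whichever positive factor scales \<open>Mv - v\<close>, the test that defines
  the new region picks out the points with \<open>Mv = v\<close> (\<open>max_zero_scaled_le_iff\<close>); at the remaining
  points \<open>Lv + f = 0\<close>. The impulse \<open>\<delta>'\<close> attains the maximum \<open>Mv\<close> because, by row decoupling, the
  maximization splits into independent problems for the components of the impulse, so that
  the pointwise largest maximizer is still a maximizer (\<open>delta_star_in_argmax_set\<close>). Hence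
  \<open>v - B(\<delta>') v = - c(\<delta>')\<close> on the region, and this equation, \<open>- L v = f\<close> and the prescription
  \<open>v = H v\<^sup>k\<close> on the opponent's region are the three kinds of rows of the linear system.

  \<^emph>\<open>The matrices.\<close> Rows of \<open>Id\<close> and \<open>- L\<close> are strictly dominant, rows of \<open>Id - B(\<delta>')\<close> weakly.
  The graph condition lets a walk leave the region, and the first row outside it is strictly
  dominant; so \<open>AA \<phi> \<phi>'\<close> is weakly chained dominant (\<open>AA_wcdd_L0\<close>). Nonsingularity is the
  maximum principle along such a walk (\<open>wcdd_imp_invertible\<close>). For the M-matrix property,
  \<open>A = s Id - P\<close> with \<open>P \<ge> 0\<close> and row sums of \<open>P\<close> at most \<open>s\<close> (\<open>wdd_L0_imp_M_matrix\<close>).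
  The spectral radius is a \<open>Max\<close>, whose value is meaningful only for a finite nonempty set; so
  the bound by the row sums needs the spectrum to be finite and nonempty as well, which follows
  from the fundamental theorem of algebra (\<open>eigenvalues_finite_nonempty\<close>).
\<close>

section \<open>Diagonally dominant matrices\<close>

lemma wdd_row_cong: "A $ i = A' $ i \<Longrightarrow> wdd_row A i = wdd_row A' i"
  by (simp add: wdd_row_def)

lemma sdd_row_cong: "A $ i = A' $ i \<Longrightarrow> sdd_row A i = sdd_row A' i"
  by (simp add: sdd_row_def)

lemma sdd_row_imp_wdd_row: "sdd_row A i \<Longrightarrow> wdd_row A i"
  by (simp add: wdd_row_def sdd_row_def)

lemma sdd_row_mat_1: "sdd_row (mat 1) i"
  by (simp add: sdd_row_def mat_def)

lemma sdd_row_loop: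
  assumes "sdd_row A i"
  shows "(i, i) \<in> mat_graph A"
proof -
  have "0 \<le> (\<Sum>j\<in>UNIV - {i}. \<bar>A $ i $ j\<bar>)"
    by (simp add: sum_nonneg)
  then have "A $ i $ i \<noteq> 0"
    using assms by (auto simp: sdd_row_def simp flip: not_le)
  then show ?thesis
    by (simp add: mat_graph_def)
qed

lemma sum_UNIV_split: "(\<Sum>j\<in>UNIV. h j) = h i + (\<Sum>j\<in>UNIV - {i}. h j)"
  for h :: "'n::finite \<Rightarrow> 'a::comm_monoid_add"
  by (simp add: sum.remove)

text \<open>Let \<open>m\<close> be the largest modulus of a component of a kernel vector. Row \<open>i\<close> of the
  equation, at a component attaining \<open>m\<close>, gives
  \<open>\<Sum>\<^bsub>j \<noteq> i\<^esub> \<bar>A\<^bsub>ij\<^esub>\<bar> (m - \<bar>u\<^bsub>j\<^esub>\<bar>) \<le> m (\<Sum>\<^bsub>j \<noteq> i\<^esub> \<bar>A\<^bsub>ij\<^esub>\<bar> - \<bar>A\<^bsub>ii\<^esub>\<bar>)\<close>.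
  The left side is nonnegative, so \<open>i\<close> is not SDD; as row \<open>i\<close> is WDD, every neighbour of \<open>i\<close>
  attains \<open>m\<close> as well. Following a walk from \<open>i\<close> to an SDD row is then a contradiction.\<close>

lemma wcdd_imp_invertible:
  fixes A :: "real^'n^'n::finite"
  assumes "wcdd A"
  shows "invertible A"
proof -
  have "u = 0" if ker: "A *v u = 0" for u
  proof (rule ccontr)
    assume "u \<noteq> 0"
    define m where "m = Max (range (\<lambda>i. \<bar>u $ i\<bar>))"
    have le_m: "\<bar>u $ i\<bar> \<le> m" for i
      by (simp add: m_def)
    obtain k where "u $ k \<noteq> 0"
      using \<open>u \<noteq> 0\<close> by (auto simp: vec_eq_iff)
    then have "m > 0"
      using le_m[of k] by linarith
    have step: "(\<Sum>j\<in>UNIV - {i}. \<bar>A $ i $ j\<bar> * (m - \<bar>u $ j\<bar>))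
        \<le> m * ((\<Sum>j\<in>UNIV - {i}. \<bar>A $ i $ j\<bar>) - \<bar>A $ i $ i\<bar>)"
      if "\<bar>u $ i\<bar> = m" for i
    proof -
      have "(\<Sum>j\<in>UNIV. A $ i $ j * u $ j) = 0"
        using ker by (simp add: vec_eq_iff matrix_vector_mult_def)
      then have "\<bar>A $ i $ i * u $ i\<bar> = \<bar>\<Sum>j\<in>UNIV - {i}. A $ i $ j * u $ j\<bar>"
        using sum_UNIV_split[of "\<lambda>j. A $ i $ j * u $ j" i] by linarith
      also have "\<dots> \<le> (\<Sum>j\<in>UNIV - {i}. \<bar>A $ i $ j\<bar> * \<bar>u $ j\<bar>)"
        using sum_abs[of "\<lambda>j. A $ i $ j * u $ j" "UNIV - {i}"] by (simp add: abs_mult)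
      finally show ?thesis
        using that by (simp add: algebra_simps sum_subtractf sum_distrib_left abs_mult)
    qed
    have nonneg: "0 \<le> \<bar>A $ i $ j\<bar> * (m - \<bar>u $ j\<bar>)" for i j
      using le_m by simp
    have sum_ge_0: "0 \<le> (\<Sum>j\<in>UNIV - {i}. \<bar>A $ i $ j\<bar> * (m - \<bar>u $ j\<bar>))" for i
      by (rule sum_nonneg) (rule nonneg)
    have not_sdd: "\<not> sdd_row A i" if "\<bar>u $ i\<bar> = m" for i
    proof
      assume "sdd_row A i"
      then have "m * ((\<Sum>j\<in>UNIV - {i}. \<bar>A $ i $ j\<bar>) - \<bar>A $ i $ i\<bar>) < 0"
        using \<open>m > 0\<close> by (simp add: sdd_row_def mult_pos_neg)
      then show False
        using step[OF that] sum_ge_0[of i] by linarith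
    qed
    have succ: "\<bar>u $ j\<bar> = m" if "\<bar>u $ i\<bar> = m" "(i, j) \<in> mat_graph A" for i j
    proof (cases "j = i")
      case False
      have "wdd_row A i"
        using assms by (simp add: wcdd_def wdd_def)
      then have "m * ((\<Sum>j\<in>UNIV - {i}. \<bar>A $ i $ j\<bar>) - \<bar>A $ i $ i\<bar>) \<le> 0"
        using \<open>m > 0\<close> by (simp add: wdd_row_def mult_le_0_iff)
      then have "(\<Sum>j\<in>UNIV - {i}. \<bar>A $ i $ j\<bar> * (m - \<bar>u $ j\<bar>)) = 0"
        using step[OF that(1)] sum_ge_0[of i] by linarith
      then have "\<bar>A $ i $ j\<bar> * (m - \<bar>u $ j\<bar>) = 0"
        using False nonneg by (subst (asm) sum_nonneg_eq_0_iff) auto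
      then show ?thesis
        using that(2) by (auto simp: mat_graph_def)
    qed (use that in simp)
    have "m \<in> range (\<lambda>i. \<bar>u $ i\<bar>)"
      unfolding m_def by (rule Max_in) auto
    then obtain i where i: "\<bar>u $ i\<bar> = m"
      by auto
    obtain j where j: "sdd_row A j" "(i, j) \<in> (mat_graph A)\<^sup>+"
      using assms by (auto simp: wcdd_def wdd_def)
    from j(2) have "\<bar>u $ j\<bar> = m"
      by (induction rule: trancl_induct) (use i succ in blast)+
    then show False
      using not_sdd j(1) by blast
  qed
  then show ?thesis
    by (simp add: invertible_left_inverse matrix_left_invertible_ker)
qed


section \<open>The spectrum of a matrix, and M-matrices\<close>

definition eigenvalues :: "'a::field^'n^'n::finite \<Rightarrow> 'a set" where
  "eigenvalues A = {\<mu>. \<exists>u. u \<noteq> 0 \<and> A *v u = \<mu> *s u}"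

lemma poly_det:
  fixes M :: "('a::comm_ring_1 poly)^'n^'n::finite"
  shows "poly (det M) x = det (\<chi> i j. poly (M $ i $ j) x)"
  by (simp add: det_def poly_sum poly_prod)

lemma eigenvalues_iff_det: "\<mu> \<in> eigenvalues A \<longleftrightarrow> det (A - mat \<mu>) = 0"
  for A :: "'a::field^'n^'n::finite"
proof -
  have mat: "mat \<mu> *v u = \<mu> *s u" for u :: "'a^'n"
  proof -
    have "(\<Sum>j\<in>UNIV. (if i = j then \<mu> else 0) * u $ j) = (\<Sum>j\<in>UNIV. if i = j then \<mu> * u $ j else 0)" for i
      by (rule sum.cong) auto
    then show ?thesis
      by (simp add: vec_eq_iff matrix_vector_mult_def mat_def)
  qed
  have "det (A - mat \<mu>) \<noteq> 0 \<longleftrightarrow> (\<forall>u. (A - mat \<mu>) *v u = 0 \<longrightarrow> u = 0)"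
    by (simp flip: invertible_det_nz
        add: invertible_left_inverse matrix_left_invertible_ker)
  then show ?thesis
    by (auto simp: eigenvalues_def matrix_vector_mult_diff_rdistrib mat)
qed

text \<open>The determinants \<open>p(x) = det (A - x Id)\<close> and \<open>q(t) = det (t A - Id)\<close> are polynomials and
  \<open>q(t) = t\<^sup>n p(1/t)\<close> for \<open>t \<noteq> 0\<close>. If \<open>p\<close> were a constant \<open>a\<close>, then \<open>q(t) = a t\<^sup>n\<close>, so
  \<open>q(0) = 0\<close>, whereas \<open>q(0) = det (- Id) \<noteq> 0\<close>. Hence \<open>p\<close> has roots, and finitely many of them.\<close>

lemma eigenvalues_finite_nonempty:
  fixes A :: "complex^'n^'n::finite"
  shows "finite (eigenvalues A)" "eigenvalues A \<noteq> {}"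
proof -
  define p where "p = det (\<chi> i j. [:A $ i $ j:] - (if i = j then [:0, 1:] else 0))"
  define q where "q = det (\<chi> i j. [:0, A $ i $ j:] - (if i = j then 1 else 0))"
  have p: "poly p x = det (A - mat x)" for x
    unfolding p_def poly_det by (intro arg_cong[where f = det]) (simp add: vec_eq_iff mat_def)
  have q: "poly q t = det (\<chi> i. t *s A $ i - mat 1 $ i)" for t
    unfolding q_def poly_det by (intro arg_cong[where f = det]) (simp add: vec_eq_iff mat_def)
  have pq: "poly q t = t ^ CARD('n) * poly p (1 / t)" if "t \<noteq> 0" for t
  proof -
    have "(\<chi> i. t *s A $ i - mat 1 $ i) = (\<chi> i. t *s (A - mat (1 / t)) $ i)"
      using that by (simp add: vec_eq_iff mat_def algebra_simps)
    then show ?thesis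
      unfolding q p using det_rows_mul[of "\<lambda>_. t" "\<lambda>i. (A - mat (1 / t)) $ i"]
      by (simp only: vec_nth_inverse prod_constant)
  qed
  have "det (\<chi> i. (0::complex) *s A $ i - mat 1 $ i) = det (\<chi> i. (- 1) *s (mat 1 :: complex^'n^'n) $ i)"
    by (intro arg_cong[where f = det]) (simp add: vec_eq_iff)
  also have "\<dots> \<noteq> 0"
    using det_rows_mul[of "\<lambda>_. -1" "\<lambda>i. (mat 1 :: complex^'n^'n) $ i"] by simp
  finally have q0: "poly q 0 \<noteq> 0"
    unfolding q .
  have not_const: "\<not> constant (poly p)"
  proof
    assume "constant (poly p)"
    then have const: "poly p x = poly p 0" for x
      unfolding constant_def by blast
    define r where "r = q - monom (poly p 0) CARD('n)"
    have "poly r t = 0" if "t \<noteq> 0" for t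
      using pq[OF that] const[of "1 / t"] by (simp add: r_def poly_monom)
    then have "- {0} \<subseteq> {t. poly r t = 0}"
      by auto
    moreover have "infinite (- {0::complex})"
      by (simp add: Compl_eq_Diff_UNIV infinite_UNIV_char_0)
    ultimately have "r = 0"
      using poly_roots_finite finite_subset by blast
    then have "q = monom (poly p 0) CARD('n)"
      by (simp add: r_def)
    then have "poly q 0 = 0"
      by (simp add: poly_monom zero_power)
    then show False
      using q0 by simp
  qed
  have eig: "eigenvalues A = {x. poly p x = 0}"
    by (auto simp: eigenvalues_iff_det p)
  have "p \<noteq> 0"
    using not_const unfolding constant_def by auto
  then show "finite (eigenvalues A)"
    by (simp add: eig poly_roots_finite)
  show "eigenvalues A \<noteq> {}"
    using fundamental_theorem_of_algebra[OF not_const] by (auto simp: eig)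
qed

text \<open>The row-sum norm bounds every eigenvalue: compare the two sides of the eigenvalue equation
  at a component of largest modulus.\<close>

lemma spec_rad_le_row_sum:
  fixes P :: "real^'n^'n::finite"
  assumes "0 \<le> P" and row_sum: "\<And>i. (\<Sum>j\<in>UNIV. P $ i $ j) \<le> s"
  shows "spec_rad P \<le> s"
proof -
  let ?Pc = "map_matrix complex_of_real P"
  have P_nonneg: "0 \<le> P $ i $ j" for i j
    using \<open>0 \<le> P\<close> by (simp add: less_eq_vec_def)
  have bound: "cmod \<mu> \<le> s" if eig: "\<mu> \<in> eigenvalues ?Pc" for \<mu>
  proof -
    obtain u where u: "u \<noteq> 0" "?Pc *v u = \<mu> *s u"
      using eig by (auto simp: eigenvalues_def)
    define m where "m = Max (range (\<lambda>i. cmod (u $ i)))"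
    have le_m: "cmod (u $ i) \<le> m" for i
      by (simp add: m_def)
    have "m \<in> range (\<lambda>i. cmod (u $ i))"
      unfolding m_def by (rule Max_in) auto
    then obtain i where i: "cmod (u $ i) = m"
      by auto
    obtain k where "u $ k \<noteq> 0"
      using u(1) by (auto simp: vec_eq_iff)
    then have "m > 0"
      using le_m[of k] by (smt (verit) zero_less_norm_iff)
    have "(\<Sum>j\<in>UNIV. complex_of_real (P $ i $ j) * u $ j) = \<mu> * u $ i"
      using u(2) by (simp add: vec_eq_iff matrix_vector_mult_def map_matrix_def)
    then have "cmod \<mu> * m = cmod (\<Sum>j\<in>UNIV. complex_of_real (P $ i $ j) * u $ j)"
      using i by (simp add: norm_mult)
    also have "\<dots> \<le> (\<Sum>j\<in>UNIV. P $ i $ j * m)"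
      by (rule sum_norm_le) (simp add: norm_mult P_nonneg le_m mult_left_mono)
    also have "\<dots> \<le> s * m"
      using row_sum[of i] \<open>m > 0\<close> by (simp flip: sum_distrib_right)
    finally show ?thesis
      using \<open>m > 0\<close> by simp
  qed
  have "spec_rad P = Max (cmod ` eigenvalues ?Pc)"
    unfolding spec_rad_def eigenvalues_def by (intro arg_cong[where f = Max]) blast
  then show ?thesis
    using eigenvalues_finite_nonempty[of ?Pc] bound by simp
qed

text \<open>With \<open>s\<close> the largest diagonal entry, \<open>s Id - A\<close> is nonnegative, and dominance says exactly
  that the row sums of \<open>A\<close> are nonnegative, hence those of \<open>s Id - A\<close> are at most \<open>s\<close>.\<close>

lemma wdd_L0_imp_M_matrix:
  fixes A :: "real^'n^'n::finite"
  assumes "wdd A" "L0_matrix A"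
  shows "M_matrix A"
proof -
  define s where "s = Max (range (\<lambda>i. A $ i $ i))"
  define P where "P = s *\<^sub>R mat 1 - A"
  have s: "A $ i $ i \<le> s" for i
    by (simp add: s_def)
  have "0 \<le> P $ i $ j" for i j
    using assms(2) s by (simp add: P_def mat_def L0_matrix_def)
  then have "0 \<le> P"
    by (simp add: less_eq_vec_def)
  moreover have "(\<Sum>j\<in>UNIV. P $ i $ j) \<le> s" for i
  proof -
    have "(\<Sum>j\<in>UNIV - {i}. P $ i $ j) = (\<Sum>j\<in>UNIV - {i}. \<bar>A $ i $ j\<bar>)"
      using assms(2) by (intro sum.cong) (auto simp: P_def mat_def L0_matrix_def)
    moreover have "(\<Sum>j\<in>UNIV - {i}. \<bar>A $ i $ j\<bar>) \<le> A $ i $ i"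
      using assms by (auto simp: wdd_def wdd_row_def L0_matrix_def)
    ultimately show ?thesis
      using sum_UNIV_split[of "\<lambda>j. P $ i $ j" i] by (simp add: P_def mat_def)
  qed
  ultimately have "spec_rad P \<le> s"
    by (rule spec_rad_le_row_sum)
  moreover have "A = s *\<^sub>R mat 1 - P"
    by (simp add: P_def)
  ultimately show ?thesis
    using \<open>0 \<le> P\<close> unfolding M_matrix_def by blast
qed


section \<open>The reflection of the grid\<close>

lemma diag_mat_mult_nth: "(diag_mat d ** A) $ x $ y = d $ x * A $ x $ y"
  by (simp add: matrix_matrix_mult_def diag_mat_def if_distrib[of "\<lambda>a. a * _"] cong: if_cong)

lemma Psi_nth: "Psi \<phi> $ x $ y = (if x = y \<and> x \<in> fst \<phi> then 1 else 0)"
  by (simp add: Psi_def diag_mat_def ind_vec_def indicator_def)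

lemma Psi_mult_nth: "(Psi \<phi> ** A) $ x $ y = (if x \<in> fst \<phi> then A $ x $ y else 0)"
  by (simp add: Psi_def diag_mat_mult_nth ind_vec_def indicator_def)

context
  fixes pt :: "'g::finite \<Rightarrow> real"
  assumes grid: "symmetric_grid pt"
begin

lemma pt_refl_pt [simp]: "pt (refl_pt pt x) = - pt x"
proof -
  have "- pt x \<in> range pt"
    using grid by (auto simp: symmetric_grid_def)
  then show ?thesis
    by (simp add: refl_pt_def f_inv_into_f)
qed

lemma refl_pt_refl_pt [simp]: "refl_pt pt (refl_pt pt x) = x"
  using grid by (intro injD[of pt]) (simp_all add: symmetric_grid_def)

lemma refl_pt_eq_iff: "refl_pt pt x = y \<longleftrightarrow> x = refl_pt pt y"
  by auto

lemma mem_refl_image_iff: "x \<in> refl_pt pt ` I \<longleftrightarrow> refl_pt pt x \<in> I"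
  by (metis image_iff refl_pt_refl_pt)

lemma bij_refl_pt: "bij (refl_pt pt)"
  by (rule o_bij[of "refl_pt pt"]) (auto simp: fun_eq_iff)

lemma refl_image_disjoint:
  assumes "I \<subseteq> G_neg pt" "x \<in> G_neg pt"
  shows "x \<notin> refl_pt pt ` I"
  using assms by (force simp: mem_refl_image_iff G_neg_def)

lemma sym_op_nth: "sym_op pt $ x $ y = (if y = refl_pt pt x then 1 else 0)"
  by (simp add: sym_op_def matrix_def axis_def eq_commute)

lemma sym_op_mult_nth: "(sym_op pt ** A) $ x $ y = A $ refl_pt pt x $ y"
  by (simp add: matrix_matrix_mult_def sym_op_nth if_distrib[of "\<lambda>a. a * _"] cong: if_cong)

lemma mult_sym_op_nth: "(A ** sym_op pt) $ x $ y = A $ x $ refl_pt pt y"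
  by (simp add: matrix_matrix_mult_def sym_op_nth refl_pt_eq_iff eq_commute[of y]
      if_distrib[of "\<lambda>a. _ * a"] cong: if_cong)

lemma sym_op_vec_nth: "(sym_op pt *v u) $ x = u $ refl_pt pt x"
  by (simp add: matrix_vector_mult_def sym_op_nth if_distrib[of "\<lambda>a. a * _"] cong: if_cong)

lemma refl_Psi_nth:
  "(sym_op pt ** Psi \<phi> ** sym_op pt) $ x $ y = (if x = y \<and> x \<in> refl_pt pt ` fst \<phi> then 1 else 0)"
  by (auto simp: mult_sym_op_nth sym_op_mult_nth Psi_nth mem_refl_image_iff refl_pt_eq_iff)


section \<open>The fixed-point matrices, row by row\<close>

text \<open>This is the projection onto the points where neither player intervenes. No diagonal entry
  is \<open>-1\<close>, because the region of \<open>\<phi>'\<close> is negative and the reflected region of \<open>\<phi>\<close> positive.\<close>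

lemma continuation_eq_diag_mat:
  assumes "fst \<phi> \<subseteq> G_neg pt" "fst \<phi>' \<subseteq> G_neg pt"
  shows "mat 1 - Psi \<phi>' - sym_op pt ** Psi \<phi> ** sym_op pt =
    diag_mat (ind_vec (- (fst \<phi>' \<union> refl_pt pt ` fst \<phi>)))"
  using assms refl_image_disjoint[OF assms(1)]
  by (auto simp: vec_eq_iff refl_Psi_nth Psi_nth mat_def diag_mat_def ind_vec_def indicator_def)

lemma AA_row:
  assumes "fst \<phi> \<subseteq> G_neg pt" "fst \<phi>' \<subseteq> G_neg pt"
  shows "AA pt L B \<phi> \<phi>' $ x =
    (if x \<in> fst \<phi>' then (mat 1 - B (snd \<phi>')) $ x
     else if x \<in> refl_pt pt ` fst \<phi> then mat 1 $ x
     else (- L) $ x)"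
  unfolding AA_def continuation_eq_diag_mat[OF assms]
  by (simp add: vec_eq_iff diag_mat_mult_nth Psi_mult_nth ind_vec_def)

lemma BB_nth:
  "BB pt B \<phi> $ x $ y =
    (if x \<in> refl_pt pt ` fst \<phi> then B (snd \<phi>) $ refl_pt pt x $ refl_pt pt y else 0)"
proof -
  have "(sym_op pt ** Psi \<phi> ** B (snd \<phi>)) = sym_op pt ** (Psi \<phi> ** B (snd \<phi>))"
    by (simp add: matrix_mul_assoc)
  then show ?thesis
    by (simp add: BB_def mult_sym_op_nth sym_op_mult_nth Psi_mult_nth mem_refl_image_iff)
qed

lemma BB_eq_diag_mat:
  "BB pt B \<phi> = diag_mat (sym_op pt *v ind_vec (fst \<phi>)) ** sym_op pt ** B (snd \<phi>) ** sym_op pt"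
proof -
  let ?d = "diag_mat (sym_op pt *v ind_vec (fst \<phi>))"
  have "?d ** sym_op pt ** B (snd \<phi>) = ?d ** (sym_op pt ** B (snd \<phi>))"
    by (simp add: matrix_mul_assoc)
  then show ?thesis
    by (simp add: vec_eq_iff BB_nth mult_sym_op_nth diag_mat_mult_nth sym_op_mult_nth
        sym_op_vec_nth ind_vec_def indicator_def mem_refl_image_iff)
qed

text \<open>On the region of \<open>\<phi>'\<close> the graph of \<open>AA\<close> agrees with that of \<open>B(\<delta>')\<close> up to loops, and
  all other rows are SDD. So a walk of \<open>B(\<delta>')\<close> that leaves the region yields, up to its first
  exit and with loops skipped, a walk of \<open>AA\<close> to an SDD row. An SDD row reaches itself by its
  own loop, as its diagonal entry is nonzero.\<close>

lemma AA_wcdd_L0: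
  assumes "fst \<phi> \<subseteq> G_neg pt" "fst \<phi>' \<subseteq> G_neg pt"
    and L: "sdd (- L)" "L0_matrix (- L)"
    and B: "wdd (mat 1 - B (snd \<phi>'))" "L0_matrix (mat 1 - B (snd \<phi>'))"
    and exit: "\<And>x. x \<in> fst \<phi>' \<Longrightarrow> \<exists>y\<in>- fst \<phi>'. (x, y) \<in> (mat_graph (B (snd \<phi>')))\<^sup>+"
  shows "wcdd (AA pt L B \<phi> \<phi>')" "L0_matrix (AA pt L B \<phi> \<phi>')"
proof -
  let ?A = "AA pt L B \<phi> \<phi>'"
  note row = AA_row[OF assms(1,2), of L B]
  have sdd: "sdd_row ?A x" if "x \<notin> fst \<phi>'" for x
  proof (cases "x \<in> refl_pt pt ` fst \<phi>")
    case True
    then have "sdd_row ?A x = sdd_row (mat 1) x"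
      using that row by (intro sdd_row_cong) simp
    then show ?thesis
      by (simp add: sdd_row_mat_1)
  next
    case False
    then have "sdd_row ?A x = sdd_row (- L) x"
      using that row by (intro sdd_row_cong) simp
    then show ?thesis
      using L(1) by (simp add: sdd_def)
  qed
  have "wdd_row ?A x" for x
  proof (cases "x \<in> fst \<phi>'")
    case True
    then have "wdd_row ?A x = wdd_row (mat 1 - B (snd \<phi>')) x"
      using row by (intro wdd_row_cong) simp
    then show ?thesis
      using B(1) by (simp add: wdd_def)
  qed (simp add: sdd sdd_row_imp_wdd_row)
  then have wdd: "wdd ?A"
    by (simp add: wdd_def)
  have edge: "(x, y) \<in> mat_graph ?A" if "x \<in> fst \<phi>'" "(x, y) \<in> mat_graph (B (snd \<phi>'))" "x \<noteq> y" for x y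
    using that row[of x] by (simp add: mat_graph_def mat_def)
  have walk: "\<exists>z. z \<notin> fst \<phi>' \<and> (x, z) \<in> (mat_graph ?A)\<^sup>*"
    if "(x, y) \<in> (mat_graph (B (snd \<phi>')))\<^sup>+" "y \<notin> fst \<phi>'" for x y
    using that
  proof (induction rule: converse_trancl_induct)
    case (base x)
    then show ?case
      by (metis edge r_into_rtrancl rtrancl.rtrancl_refl)
  next
    case (step x x')
    then show ?case
      by (metis edge converse_rtrancl_into_rtrancl rtrancl.rtrancl_refl)
  qed
  have "\<exists>z. sdd_row ?A z \<and> (x, z) \<in> (mat_graph ?A)\<^sup>+" for x
  proof (cases "x \<in> fst \<phi>'")
    case True
    then obtain z where "z \<notin> fst \<phi>'" "(x, z) \<in> (mat_graph ?A)\<^sup>*"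
      using exit walk by blast
    then show ?thesis
      using True sdd by (metis rtranclD)
  next
    case False
    then show ?thesis
      using sdd sdd_row_loop by blast
  qed
  then show "wcdd ?A"
    using wdd by (simp add: wcdd_def)
  show "L0_matrix ?A"
    using L(2) B(2) by (auto simp: L0_matrix_def row mat_def)
qed

text \<open>For an \<open>L\<^sub>0\<close>-matrix \<open>Id - B\<close>, weak dominance of a row says that the row sum of \<open>B\<close> is at
  most one; \<open>BB\<close> consists of reflected rows of \<open>B\<close> and of zero rows.\<close>

lemma BB_substochastic:
  assumes wdd: "wdd (mat 1 - B (snd \<phi>))" and L0: "L0_matrix (mat 1 - B (snd \<phi>))"
    and diag: "\<And>x. B (snd \<phi>) $ x $ x \<ge> 0"
  shows "substochastic (BB pt B \<phi>)"
proof -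
  let ?B = "B (snd \<phi>)"
  have "0 \<le> ?B $ x $ y" for x y
    using L0 diag by (cases "x = y") (auto simp: L0_matrix_def mat_def split: if_splits)
  then have "0 \<le> BB pt B \<phi>"
    by (simp add: less_eq_vec_def BB_nth)
  moreover have "(\<Sum>y\<in>UNIV. BB pt B \<phi> $ x $ y) \<le> 1" for x
  proof -
    have row_sum: "(\<Sum>y\<in>UNIV. ?B $ x $ y) \<le> 1" for x
    proof -
      have "(\<Sum>y\<in>UNIV - {x}. ?B $ x $ y) = (\<Sum>y\<in>UNIV - {x}. \<bar>(mat 1 - ?B) $ x $ y\<bar>)"
        using L0 by (intro sum.cong) (auto simp: L0_matrix_def mat_def split: if_splits)
      also have "\<dots> \<le> 1 - ?B $ x $ x"
        using wdd L0 by (auto simp: wdd_def wdd_row_def L0_matrix_def mat_def split: if_splits)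
      finally show ?thesis
        using sum_UNIV_split[of "\<lambda>y. ?B $ x $ y" x] by simp
    qed
    have "(\<Sum>y\<in>UNIV. ?B $ refl_pt pt x $ refl_pt pt y) = (\<Sum>y\<in>UNIV. ?B $ refl_pt pt x $ y)"
      by (rule sum.reindex_bij_betw[OF bij_refl_pt])
    then show ?thesis
      using row_sum[of "refl_pt pt x"] by (cases "x \<in> refl_pt pt ` fst \<phi>") (simp_all add: BB_nth)
  qed
  ultimately show ?thesis
    by (simp add: substochastic_def)
qed

end


section \<open>The pointwise optimal impulse\<close>

lemma finite_impulses:
  fixes Z :: "'g::finite \<Rightarrow> real set"
  assumes "\<And>x. finite (Z x)"
  shows "finite (impulses Z)"
proof (rule finite_subset)
  show "impulses Z \<subseteq> vec_lambda ` (PiE UNIV Z)"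
  proof
    fix \<delta> assume "\<delta> \<in> impulses Z"
    then have "\<delta> = vec_lambda (vec_nth \<delta>)" "vec_nth \<delta> \<in> PiE UNIV Z"
      by (auto simp: impulses_def)
    then show "\<delta> \<in> vec_lambda ` (PiE UNIV Z)"
      by blast
  qed
  show "finite (vec_lambda ` (PiE UNIV Z))"
    using assms by (intro finite_imageI finite_PiE) auto
qed

lemma impulses_nonempty:
  assumes "\<And>x. Z x \<noteq> {}"
  shows "impulses Z \<noteq> {}"
proof -
  have "(\<chi> x. SOME z. z \<in> Z x) \<in> impulses Z"
    using assms by (simp add: impulses_def some_in_eq)
  then show ?thesis
    by blast
qed

context
  fixes Z :: "'g::finite \<Rightarrow> real set"
    and B :: "real^'g \<Rightarrow> real^'g^'g" and c :: "real^'g \<Rightarrow> real^'g"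
  assumes Z: "\<And>x. finite (Z x)" "\<And>x. Z x \<noteq> {}"
begin

lemma M_op_attained: "\<exists>\<delta>\<in>impulses Z. (B \<delta> *v u - c \<delta>) $ x = M_op Z B c u $ x"
proof -
  have "M_op Z B c u $ x \<in> (\<lambda>\<delta>. (B \<delta> *v u - c \<delta>) $ x) ` impulses Z"
    unfolding M_op_def vec_lambda_beta
    by (rule Max_in) (auto simp: finite_impulses Z impulses_nonempty)
  then show ?thesis
    by force
qed

lemma M_op_upper: "\<delta> \<in> impulses Z \<Longrightarrow> (B \<delta> *v u - c \<delta>) $ x \<le> M_op Z B c u $ x"
  unfolding M_op_def vec_lambda_beta
  by (rule Max_ge) (auto simp: finite_impulses Z)

text \<open>The pointwise maximum over a finite set is attained in each row, so an impulse that
  dominates all others in the pointwise order attains it in all rows.\<close>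

lemma mem_argmax_set_iff:
  "\<delta> \<in> argmax_set Z B c u \<longleftrightarrow> \<delta> \<in> impulses Z \<and> B \<delta> *v u - c \<delta> = M_op Z B c u"
proof
  assume \<delta>: "\<delta> \<in> argmax_set Z B c u"
  have "(B \<delta> *v u - c \<delta>) $ x = M_op Z B c u $ x" for x
  proof (rule antisym)
    show "(B \<delta> *v u - c \<delta>) $ x \<le> M_op Z B c u $ x"
      using \<delta> by (intro M_op_upper) (simp add: argmax_set_def)
    obtain \<delta>' where "\<delta>' \<in> impulses Z" "(B \<delta>' *v u - c \<delta>') $ x = M_op Z B c u $ x"
      using M_op_attained by blast
    then show "M_op Z B c u $ x \<le> (B \<delta> *v u - c \<delta>) $ x"
      using \<delta> unfolding argmax_set_def less_eq_vec_def by (metis (lifting) mem_Collect_eq)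
  qed
  then show "\<delta> \<in> impulses Z \<and> B \<delta> *v u - c \<delta> = M_op Z B c u"
    using \<delta> unfolding vec_eq_iff argmax_set_def by simp
next
  assume "\<delta> \<in> impulses Z \<and> B \<delta> *v u - c \<delta> = M_op Z B c u"
  then show "\<delta> \<in> argmax_set Z B c u"
    using M_op_upper by (simp add: argmax_set_def less_eq_vec_def del: vector_minus_component)
qed

context
  fixes pt :: "'g \<Rightarrow> real" and g :: "real^'g \<Rightarrow> real^'g"
  assumes decoupled: "row_decoupled pt Z B c g"
begin

lemma objective_row_cong:
  assumes "\<delta> \<in> impulses Z" "\<delta>' \<in> impulses Z" "\<delta> $ x = \<delta>' $ x"
  shows "(B \<delta> *v u - c \<delta>) $ x = (B \<delta>' *v u - c \<delta>') $ x"
proof -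
  have "row x (B \<delta>) = row x (B \<delta>')" "c \<delta> $ x = c \<delta>' $ x"
    using decoupled assms unfolding row_decoupled_def by blast+
  then show ?thesis
    by (simp add: row_def matrix_vector_mult_def vec_eq_iff)
qed

text \<open>By row decoupling each row of the objective sees one component of the impulse only, so
  impulses that are each optimal in one row glue to an impulse that is optimal in all rows at
  once. Gluing produces a first maximizer, and shows that the componentwise largest maximizer is
  one.\<close>

lemma glue_impulses:
  assumes "\<And>x. \<exists>\<delta>'\<in>impulses Z. \<delta>' $ x = \<delta> $ x \<and> (B \<delta>' *v u - c \<delta>') $ x = M_op Z B c u $ x"
  shows "\<delta> \<in> impulses Z" "B \<delta> *v u - c \<delta> = M_op Z B c u"
proof -
  show \<delta>: "\<delta> \<in> impulses Z"
    unfolding impulses_def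
  proof (intro CollectI allI)
    fix x
    obtain \<delta>' where "\<delta>' \<in> impulses Z" "\<delta>' $ x = \<delta> $ x"
      using assms by blast
    then show "\<delta> $ x \<in> Z x"
      unfolding impulses_def by (metis mem_Collect_eq)
  qed
  show "B \<delta> *v u - c \<delta> = M_op Z B c u"
    unfolding vec_eq_iff using assms objective_row_cong[OF \<delta>] by metis
qed

lemma argmax_set_nonempty: "argmax_set Z B c u \<noteq> {}"
proof -
  have "\<forall>x. \<exists>\<delta>. \<delta> \<in> impulses Z \<and> (B \<delta> *v u - c \<delta>) $ x = M_op Z B c u $ x"
    using M_op_attained by blast
  then obtain D where D: "\<And>x. D x \<in> impulses Z"
      "\<And>x. (B (D x) *v u - c (D x)) $ x = M_op Z B c u $ x"
    by metis
  have glue: "\<exists>\<delta>'\<in>impulses Z. \<delta>' $ x = (\<chi> y. D y $ y) $ x \<and>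
      (B \<delta>' *v u - c \<delta>') $ x = M_op Z B c u $ x" for x
    using D by auto
  show ?thesis
    using glue_impulses[of "\<chi> y. D y $ y", OF glue] mem_argmax_set_iff by blast
qed

lemma delta_star_in_argmax_set: "delta_star Z B c u \<in> argmax_set Z B c u"
proof -
  have "finite (argmax_set Z B c u)"
    using finite_impulses[of Z] Z(1) by (simp add: argmax_set_def)
  then have "delta_star Z B c u $ x \<in> (\<lambda>\<delta>. \<delta> $ x) ` argmax_set Z B c u" for x
    unfolding delta_star_def vec_lambda_beta using argmax_set_nonempty by (intro Max_in) auto
  then have glue: "\<exists>\<delta>'\<in>impulses Z. \<delta>' $ x = delta_star Z B c u $ x \<and>
      (B \<delta>' *v u - c \<delta>') $ x = M_op Z B c u $ x" for x
    unfolding image_iff by (metis mem_argmax_set_iff)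
  show ?thesis
    using glue_impulses[OF glue] by (simp add: mem_argmax_set_iff)
qed

end

end


section \<open>The iteration as a fixed-point scheme\<close>

text \<open>Read \<open>a = Lv + f\<close> and \<open>b = Mv - v\<close> at a point where the variational inequality
  \<open>max a b = 0\<close> holds: either \<open>b = 0 \<ge> a\<close>, or \<open>b < 0 = a\<close>. The test \<open>a \<le> s b\<close> separates
  the two cases for every \<open>s > 0\<close>, which is why the intervention region is the same for all
  scaling factors and consists of the points with \<open>Mv = v\<close>.\<close>

lemma max_zero_scaled_le_iff:
  fixes a b s :: real
  assumes "max a b = 0" "s > 0"
  shows "a \<le> s * b \<longleftrightarrow> b = 0"
proof (cases "b = 0")
  case False
  then have "b < 0" "a = 0"
    using assms(1) by (auto simp: max_def split: if_splits)
  then show ?thesis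
    using assms(2) by (simp add: zero_le_mult_iff)
qed (use assms in auto)

theorem proposition2p4p2:
  fixes pt :: "'g::finite \<Rightarrow> real"
    and L :: "real^'g^'g" and f :: "real^'g"
    and Z :: "'g \<Rightarrow> real set"
    and B :: "real^'g \<Rightarrow> real^'g^'g" and c g :: "real^'g \<Rightarrow> real^'g"
    and lam :: real
    and v :: "nat \<Rightarrow> real^'g" and \<phi> :: "nat \<Rightarrow> 'g set \<times> (real^'g)"
  assumes grid: "symmetric_grid pt"
    and Z: "\<And>x. finite (Z x) \<and> Z x \<noteq> {}" "\<And>x. pt x \<ge> 0 \<Longrightarrow> Z x = {0}"
    and c: "\<And>\<delta> x. \<delta> \<in> impulses Z \<Longrightarrow> c \<delta> $ x > 0"
    and decoupled: "row_decoupled pt Z B c g"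
    and lam: "lam > 0"
    and A0: "\<And>I \<delta> x. (I, \<delta>) \<in> strategies pt Z \<Longrightarrow> x \<in> I \<Longrightarrow>
               \<exists>y\<in>- I. (x, y) \<in> (mat_graph (B \<delta>))\<^sup>+"
    and A1: "sdd (- L) \<and> L0_matrix (- L)"
            "\<And>\<delta>. \<delta> \<in> impulses Z \<Longrightarrow> wdd (mat 1 - B \<delta>) \<and> L0_matrix (mat 1 - B \<delta>)"
    and A2: "\<And>\<delta> x. \<delta> \<in> impulses Z \<Longrightarrow> B \<delta> $ x $ x \<ge> 0"
    and run: "algorithm_run pt L f Z B c g lam v \<phi>"
  shows "(\<forall>k. AA pt L B (\<phi> k) (\<phi> (Suc k)) *v v (Suc k)
               = BB pt B (\<phi> k) *v v k + CC pt f c g (\<phi> k) (\<phi> (Suc k))) \<and>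
         (\<forall>k. ind_vec (fst (\<phi> k))
               = ind_vec ({x. (L *v v k + f) $ x \<le> (M_op Z B c (v k) - v k) $ x} \<inter> G_neg pt) \<and>
              snd (\<phi> k) \<in> argmax_set Z B c (v k)) \<and>
         (\<forall>\<alpha>\<in>strategies pt Z. \<forall>\<beta>\<in>strategies pt Z.
              wcdd (AA pt L B \<alpha> \<beta>) \<and> L0_matrix (AA pt L B \<alpha> \<beta>) \<and>
              invertible (AA pt L B \<alpha> \<beta>) \<and> M_matrix (AA pt L B \<alpha> \<beta>)) \<and>
         (\<forall>\<alpha>\<in>strategies pt Z.
              BB pt B \<alpha> = diag_mat (sym_op pt *v ind_vec (fst \<alpha>)) ** sym_op pt ** B (snd \<alpha>) ** sym_op pt \<and>
              substochastic (BB pt B \<alpha>))"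
proof -
  note Z' = Z(1)[THEN conjunct1] Z(1)[THEN conjunct2]
  note AA_row = AA_row[OF grid]
  have step: "solves_on L f Z B c (- (refl_pt pt ` fst (\<phi> k)))
        (half_step pt B g (\<phi> k) (v k)) (v (Suc k))"
      "fst (\<phi> (Suc k)) = {x \<in> - (refl_pt pt ` fst (\<phi> k)).
        (L *v v (Suc k) + f) $ x \<le> lam * (M_op Z B c (v (Suc k)) - v (Suc k)) $ x}"
      "fst (\<phi> (Suc k)) \<subseteq> G_neg pt"
      "snd (\<phi> (Suc k)) = delta_star Z B c (v (Suc k))" for k
    using run by (auto simp: algorithm_run_def Let_def)
  have start: "fst (\<phi> 0) = {x. (L *v v 0 + f) $ x \<le> (M_op Z B c (v 0) - v 0) $ x} \<inter> G_neg pt"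
      "snd (\<phi> 0) = delta_star Z B c (v 0)"
    using run by (auto simp: algorithm_run_def)
  have neg: "fst (\<phi> k) \<subseteq> G_neg pt" for k
    by (cases k) (auto simp: start step(3)[THEN subsetD])
  have argmax: "snd (\<phi> k) \<in> argmax_set Z B c (v k)" for k
    using delta_star_in_argmax_set[OF Z' decoupled] by (cases k) (simp_all add: start step(4))
  have complementarity:
      "max ((L *v v (Suc k) + f) $ x) ((M_op Z B c (v (Suc k)) - v (Suc k)) $ x) = 0"
    if "x \<notin> refl_pt pt ` fst (\<phi> k)" for k x
    using step(1)[of k] that by (simp add: solves_on_def)
  have region: "x \<in> fst (\<phi> (Suc k)) \<longleftrightarrow> M_op Z B c (v (Suc k)) $ x = v (Suc k) $ x"
    if "x \<notin> refl_pt pt ` fst (\<phi> k)" for k x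
    unfolding step(2) using that max_zero_scaled_le_iff[OF complementarity[OF that] lam] by simp

  \<comment> \<open>The points removed from \<open>D\<close> are positive, so restricting to \<open>D\<close> or to the negative
    points leaves the same region.\<close>
  have regions: "fst (\<phi> k) = {x. (L *v v k + f) $ x \<le> (M_op Z B c (v k) - v k) $ x} \<inter> G_neg pt" for k
  proof (cases k)
    case (Suc n)
    have "x \<in> fst (\<phi> (Suc n)) \<longleftrightarrow>
        (L *v v (Suc n) + f) $ x \<le> (M_op Z B c (v (Suc n)) - v (Suc n)) $ x"
      if "x \<in> G_neg pt" for x
    proof -
      have x: "x \<notin> refl_pt pt ` fst (\<phi> n)"
        by (rule refl_image_disjoint[OF grid neg that])
      show ?thesis
        using max_zero_scaled_le_iff[OF complementarity[OF x], of 1] region[OF x] by simp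
    qed
    then show ?thesis
      unfolding Suc using neg[of "Suc n"] by blast
  qed (simp add: start)

  \<comment> \<open>Row \<open>x\<close> is the opponent's impulse \<open>v = H v\<^sup>k\<close>, the own impulse \<open>v - B v = - c\<close> or the
    continuation equation \<open>- L v = f\<close>, according to where \<open>x\<close> lies.\<close>
  have fixed_point: "AA pt L B (\<phi> k) (\<phi> (Suc k)) *v v (Suc k)
      = BB pt B (\<phi> k) *v v k + CC pt f c g (\<phi> k) (\<phi> (Suc k))" for k
  proof -
    let ?\<delta> = "snd (\<phi> (Suc k))" and ?R = "refl_pt pt ` fst (\<phi> k)"
    let ?Av = "AA pt L B (\<phi> k) (\<phi> (Suc k)) *v v (Suc k)"
    have mult_row: "(A *v u) $ x = (A' *v u) $ x" if "A $ x = A' $ x"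
      for A A' :: "real^'g^'g" and u x
      using that by (simp add: matrix_vector_mult_def)
    have diag: "(diag_mat d *v u) $ x = d $ x * u $ x" for d u :: "real^'g" and x
      by (simp add: matrix_vector_mult_def diag_mat_def if_distrib[of "\<lambda>a. a * _"] cong: if_cong)
    have Psi_vec: "(Psi \<alpha> *v u) $ x = (if x \<in> fst \<alpha> then u $ x else 0)"
      for \<alpha> :: "'g set \<times> (real^'g)" and u x
      by (simp add: Psi_def diag ind_vec_def)
    have CC: "CC pt f c g (\<phi> k) (\<phi> (Suc k)) $ x =
        (if x \<in> fst (\<phi> (Suc k)) \<union> ?R then 0 else f $ x)
        - (if x \<in> fst (\<phi> (Suc k)) then c ?\<delta> $ x else 0)
        + (if x \<in> ?R then g (sym_op pt *v snd (\<phi> k)) $ x else 0)" for x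
      by (simp add: CC_def continuation_eq_diag_mat[OF grid neg neg] diag Psi_vec ind_vec_def
          sym_op_vec_nth[OF grid] mem_refl_image_iff[OF grid] grid refl_pt_refl_pt
          flip: matrix_vector_mul_assoc)
    have BB: "(BB pt B (\<phi> k) *v v k) $ x =
        (if x \<in> ?R then ((sym_op pt ** B (snd (\<phi> k)) ** sym_op pt) *v v k) $ x else 0)" for x
      by (simp add: matrix_vector_mult_def BB_nth[OF grid] sym_op_mult_nth[OF grid]
          mult_sym_op_nth[OF grid])
    have "?Av $ x = (BB pt B (\<phi> k) *v v k + CC pt f c g (\<phi> k) (\<phi> (Suc k))) $ x" for x
    proof (cases "x \<in> ?R")
      case True
      have x: "x \<notin> fst (\<phi> (Suc k))"
        using refl_image_disjoint[OF grid neg] neg True by blast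
      have "?Av $ x = (mat 1 *v v (Suc k)) $ x"
        using x True by (intro mult_row) (simp add: AA_row[OF neg neg])
      also have "\<dots> = half_step pt B g (\<phi> k) (v k) $ x"
        using step(1)[of k] True by (auto simp only: solves_on_def matrix_vector_mul_lid)
      also have "\<dots> = H_op pt B g (snd (\<phi> k)) (v k) $ x"
        using True by (simp add: half_step_def)
      finally show ?thesis
        using x True by (simp add: BB CC H_op_def)
    next
      case not_R: False
      show ?thesis
      proof (cases "x \<in> fst (\<phi> (Suc k))")
        case True
        have "?Av $ x = ((mat 1 - B ?\<delta>) *v v (Suc k)) $ x"
          using True by (intro mult_row) (simp add: AA_row[OF neg neg])
        also have "\<dots> = v (Suc k) $ x - (B ?\<delta> *v v (Suc k)) $ x"
          by (simp add: matrix_vector_mult_diff_rdistrib)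
        also have "\<dots> = v (Suc k) $ x - (M_op Z B c (v (Suc k)) $ x + c ?\<delta> $ x)"
        proof -
          have "(B ?\<delta> *v v (Suc k) - c ?\<delta>) $ x = M_op Z B c (v (Suc k)) $ x"
            using argmax[of "Suc k"] by (simp only: mem_argmax_set_iff[OF Z'])
          then show ?thesis
            by simp
        qed
        also have "\<dots> = - c ?\<delta> $ x"
          using region[OF not_R] True by simp
        finally show ?thesis
          using not_R True by (simp add: BB CC)
      next
        case False
        have "(L *v v (Suc k) + f) $ x = 0"
          using complementarity[OF not_R] region[OF not_R] False
          by (auto simp: max_def split: if_splits)
        moreover have "?Av $ x = ((- L) *v v (Suc k)) $ x"
          using not_R False by (intro mult_row) (simp add: AA_row[OF neg neg])
        moreover have "((- L) *v v (Suc k)) $ x = - (L *v v (Suc k)) $ x"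
          by (simp add: matrix_vector_mult_def sum_negf)
        ultimately show ?thesis
          using not_R False by (simp add: BB CC)
      qed
    qed
    then show ?thesis
      by (simp add: vec_eq_iff)
  qed

  have matrices: "wcdd (AA pt L B \<alpha> \<beta>) \<and> L0_matrix (AA pt L B \<alpha> \<beta>) \<and>
      invertible (AA pt L B \<alpha> \<beta>) \<and> M_matrix (AA pt L B \<alpha> \<beta>)"
    if "\<alpha> \<in> strategies pt Z" "\<beta> \<in> strategies pt Z" for \<alpha> \<beta>
  proof -
    have "fst \<alpha> \<subseteq> G_neg pt" and \<beta>: "fst \<beta> \<subseteq> G_neg pt" "snd \<beta> \<in> impulses Z"
      using that by (auto simp: strategies_def)
    moreover have "\<exists>y\<in>- fst \<beta>. (x, y) \<in> (mat_graph (B (snd \<beta>)))\<^sup>+" if "x \<in> fst \<beta>" for x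
      using A0[of "fst \<beta>" "snd \<beta>" x] \<open>\<beta> \<in> strategies pt Z\<close> that by simp
    ultimately have "wcdd (AA pt L B \<alpha> \<beta>)" "L0_matrix (AA pt L B \<alpha> \<beta>)"
      using AA_wcdd_L0[OF grid, of \<alpha> \<beta> L B] A1(1) A1(2)[OF \<beta>(2)] by blast+
    then show ?thesis
      using wcdd_imp_invertible wdd_L0_imp_M_matrix wcdd_def by blast
  qed

  have "substochastic (BB pt B \<alpha>)" if "\<alpha> \<in> strategies pt Z" for \<alpha>
  proof -
    have "snd \<alpha> \<in> impulses Z"
      using that by (auto simp: strategies_def)
    then show ?thesis
      using BB_substochastic[OF grid] A1(2) A2 by blast
  qed
  then show ?thesis
    using fixed_point regions argmax matrices BB_eq_diag_mat[OF grid, of B] by auto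
qed

end
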